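(* Let $R$ be an associative ring with identity. The morphism $\lambda_R:G_0(R)\to H_0(R)$ induced by the rule $$[B\,|\,A]\;\mapsto\;[B\,|\,A]-0_1 \mod B_0(R)$$ on generators $[B\,|\,A]\in L_1(R)$ is an isomorphism of abelian groups, natural in $R$.
   Context: For $n\ge1$, $L'_n(R)$ is the collection of pairs $(B\,|\,A)$ of matrices over $R$ such that $A$ has $n$ columns and $B$ has the same number of rows as $A$ (the number of rows, and the number of columns of $B$, are arbitrary). $(B\,|\,A)\le_n(B'\,|\,A')$ holds if there are matrices $U,V,G$ over $R$, of appropriate size, with $UB=B'V$ and $UA=A'+B'G$; this is a pre-order, and $\approx_n$ is the associated equivalence relation. $L_n(R)$ is the set of $\approx_n$-classes $[B\,|\,A]$ with the induced partial order. The minimum element of $L_1(R)$ is $0_1=[0\,|\,1]$. $G_0(R)$ is the free abelian group on the elements of $L_1(R)$ modulo the relations: (1) $[B,A\,|\,A']-[B\,|\,A']=[B,A'\,|\,A]-[B\,|\,A]$ whenever $A,A'$ are column matrices and $A,A',B$ have the same number of rows; (2) $0_1=0$. For $n\ge 1$ and $[B\,|\,A]\in L_{n+1}(R)$ with columns indexed $A=(A_0,\dots,A_n)$, let $\hat A_i$ be $A$ with column $A_i$ removed and put $E_i[B\,|\,A]=[B,A_i\,|\,\hat A_i]$, $N_i[B\,|\,A]=[B\,|\,\hat A_i]$ in $L_n(R)$ (these are well defined). The complex $Q_*(R)$ has $Q_n(R)$ the free abelian group on $L_{n+1}(R)$ for $n\ge0$, $Q_{-1}(R)=\mathbb Z$,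 and $Q_n(R)=0$ for $n<-1$; the boundary is $\partial_n=\sum_{i=0}^n(-1)^i(E_i-N_i)$ for $n>0$, $\partial_0=\epsilon:Q_0(R)\to\mathbb Z$ with $\epsilon([B\,|\,A])=1$ on generators, and $\partial_n=0$ for $n\le-1$. $Z_0(R)=\ker\epsilon$ is the group of 0-cycles, $B_0(R)=\operatorname{im}\partial_1$ is the group of 0-boundaries, and $H_0(R)=Z_0(R)/B_0(R)$. A ring morphism $f:R\to S$ acts on all these groups by $[B\,|\,A]\mapsto[f(B)\,|\,f(A)]$, with $f$ applied entrywise; naturality is with respect to these maps. *)

theory Defs
  imports
    "Jordan_Normal_Form.Matrix"
    "HOL-Algebra.Free_Abelian_Groups"
    "HOL-Algebra.Elementary_Groups"
begin

section \<open>Matrices over a ring\<close>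

text \<open>
  The ring is an explicit, possibly trivial and possibly non-commutative \<open>ring\<close> of HOL-Algebra.
  (The class \<open>ring_1\<close> would exclude the trivial ring.)  The type \<open>'a mat\<close> is used only as a
  container of entries: the operations it inherits from the type classes of \<open>'a\<close> are unrelated
  to the ring structure, so sum and product are defined afresh.  Matrices with no rows or no
  columns are allowed, and their dimensions are part of the matrix.
\<close>

definition mats :: "('a, 'c) ring_scheme \<Rightarrow> nat \<Rightarrow> nat \<Rightarrow> 'a mat set" where
  "mats R m n = {M \<in> carrier_mat m n. elements_mat M \<subseteq> carrier R}"

definition madd :: "('a, 'c) ring_scheme \<Rightarrow> 'a mat \<Rightarrow> 'a mat \<Rightarrow> 'a mat" where
  "madd R M N = mat (dim_row M) (dim_col M) (\<lambda>(i, j). M $$ (i, j) \<oplus>\<^bsub>R\<^esub> N $$ (i, j))"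

definition mmult :: "('a, 'c) ring_scheme \<Rightarrow> 'a mat \<Rightarrow> 'a mat \<Rightarrow> 'a mat" where
  "mmult R M N = mat (dim_row M) (dim_col N)
     (\<lambda>(i, j). finsum R (\<lambda>k. M $$ (i, k) \<otimes>\<^bsub>R\<^esub> N $$ (k, j)) {..<dim_col M})"

definition hcat :: "'a mat \<Rightarrow> 'a mat \<Rightarrow> 'a mat" where
  "hcat M N = mat (dim_row M) (dim_col M + dim_col N)
     (\<lambda>(i, j). if j < dim_col M then M $$ (i, j) else N $$ (i, j - dim_col M))"

definition column :: "'a mat \<Rightarrow> nat \<Rightarrow> 'a mat" where
  "column A i = mat (dim_row A) 1 (\<lambda>(r, _). A $$ (r, i))"

definition remove_column :: "'a mat \<Rightarrow> nat \<Rightarrow> 'a mat" where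
  "remove_column A i = mat (dim_row A) (dim_col A - 1)
     (\<lambda>(r, j). A $$ (r, if j < i then j else Suc j))"

section \<open>The partially ordered sets $L_n(R)$\<close>

text \<open>The pair \<open>(B, A)\<close> stands for $(B\,|\,A)$.\<close>

definition L_pre :: "('a, 'c) ring_scheme \<Rightarrow> nat \<Rightarrow> ('a mat \<times> 'a mat) set" where
  "L_pre R n = {(B, A). \<exists>r m. B \<in> mats R r m \<and> A \<in> mats R r n}"

definition L_le :: "('a, 'c) ring_scheme \<Rightarrow> nat \<Rightarrow> 'a mat \<times> 'a mat \<Rightarrow> 'a mat \<times> 'a mat \<Rightarrow> bool" where
  "L_le R n = (\<lambda>(B, A) (B', A').
     \<exists>U \<in> mats R (dim_row B') (dim_row B).
     \<exists>V \<in> mats R (dim_col B') (dim_col B).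
     \<exists>G \<in> mats R (dim_col B') n.
       mmult R U B = mmult R B' V \<and> mmult R U A = madd R A' (mmult R B' G))"

definition L_equiv :: "('a, 'c) ring_scheme \<Rightarrow> nat \<Rightarrow> (('a mat \<times> 'a mat) \<times> ('a mat \<times> 'a mat)) set" where
  "L_equiv R n = {(x, y). x \<in> L_pre R n \<and> y \<in> L_pre R n \<and> L_le R n x y \<and> L_le R n y x}"

definition L :: "('a, 'c) ring_scheme \<Rightarrow> nat \<Rightarrow> ('a mat \<times> 'a mat) set set" where
  "L R n = L_pre R n // L_equiv R n"

definition L_class :: "('a, 'c) ring_scheme \<Rightarrow> nat \<Rightarrow> 'a mat \<times> 'a mat \<Rightarrow> ('a mat \<times> 'a mat) set" where
  "L_class R n x = L_equiv R n `` {x}"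

definition L_zero :: "('a, 'c) ring_scheme \<Rightarrow> ('a mat \<times> 'a mat) set" where
  "L_zero R = L_class R 1 (mat 1 1 (\<lambda>_. \<zero>\<^bsub>R\<^esub>), mat 1 1 (\<lambda>_. \<one>\<^bsub>R\<^esub>))"

text \<open>
  Maps out of a set of classes or cosets are obtained from a map on representatives with
  \<open>the_elem\<close>; such a value is meaningful exactly when the map on representatives is constant
  on the class.
\<close>

definition L_map :: "('b, 'd) ring_scheme \<Rightarrow> nat \<Rightarrow> ('a \<Rightarrow> 'b)
    \<Rightarrow> ('a mat \<times> 'a mat) set \<Rightarrow> ('b mat \<times> 'b mat) set" where
  "L_map S n f X = the_elem ((\<lambda>(B, A). L_class S n (map_mat f B, map_mat f A)) ` X)"

definition quotient_map :: "('b, 'd) monoid_scheme \<Rightarrow> 'b set \<Rightarrow> ('a \<Rightarrow> 'b) \<Rightarrow> 'a set \<Rightarrow> 'b set" where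
  "quotient_map H K h X = the_elem ((\<lambda>x. K #>\<^bsub>H\<^esub> h x) ` X)"

section \<open>The group $G_0(R)$\<close>

definition G0_relators :: "('a, 'c) ring_scheme \<Rightarrow> (('a mat \<times> 'a mat) set \<Rightarrow>\<^sub>0 int) set" where
  "G0_relators R =
     {(frag_of (L_class R 1 (hcat B A, A')) - frag_of (L_class R 1 (B, A')))
        - (frag_of (L_class R 1 (hcat B A', A)) - frag_of (L_class R 1 (B, A))) | B A A' r m.
        B \<in> mats R r m \<and> A \<in> mats R r 1 \<and> A' \<in> mats R r 1}
     \<union> {frag_of (L_zero R)}"

definition G0_kernel :: "('a, 'c) ring_scheme \<Rightarrow> (('a mat \<times> 'a mat) set \<Rightarrow>\<^sub>0 int) set" where
  "G0_kernel R = generate (free_Abelian_group (L R 1)) (G0_relators R)"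

definition G0 :: "('a, 'c) ring_scheme \<Rightarrow> (('a mat \<times> 'a mat) set \<Rightarrow>\<^sub>0 int) set monoid" where
  "G0 R = free_Abelian_group (L R 1) Mod G0_kernel R"

section \<open>The complex $Q_*(R)$ and $H_0(R)$\<close>

text \<open>
  Only the degrees $n \ge 0$ are given by \<open>Q\<close>; in degree $-1$ the complex is \<open>integer_group\<close>,
  with boundary map \<open>augmentation\<close> from degree $0$.  The map \<open>boundary R n\<close> is meant
  for $n \ge 1$.  The maps \<open>L_E R n i\<close> and \<open>L_N R n i\<close> go from $L_{n+1}(R)$ to $L_n(R)$.
\<close>

definition Q :: "('a, 'c) ring_scheme \<Rightarrow> nat \<Rightarrow> (('a mat \<times> 'a mat) set \<Rightarrow>\<^sub>0 int) monoid" where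
  "Q R n = free_Abelian_group (L R (n + 1))"

definition L_E :: "('a, 'c) ring_scheme \<Rightarrow> nat \<Rightarrow> nat \<Rightarrow> ('a mat \<times> 'a mat) set \<Rightarrow> ('a mat \<times> 'a mat) set" where
  "L_E R n i X =
     the_elem ((\<lambda>(B, A). L_class R n (hcat B (column A i), remove_column A i)) ` X)"

definition L_N :: "('a, 'c) ring_scheme \<Rightarrow> nat \<Rightarrow> nat \<Rightarrow> ('a mat \<times> 'a mat) set \<Rightarrow> ('a mat \<times> 'a mat) set" where
  "L_N R n i X = the_elem ((\<lambda>(B, A). L_class R n (B, remove_column A i)) ` X)"

definition boundary :: "('a, 'c) ring_scheme \<Rightarrow> nat
    \<Rightarrow> (('a mat \<times> 'a mat) set \<Rightarrow>\<^sub>0 int) \<Rightarrow> (('a mat \<times> 'a mat) set \<Rightarrow>\<^sub>0 int)" where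
  "boundary R n = frag_extend (\<lambda>X.
     \<Sum>i = 0..n. frag_cmul ((-1) ^ i) (frag_of (L_E R n i X) - frag_of (L_N R n i X)))"

text \<open>The additive extension of the constant map $1$ on generators.\<close>

definition augmentation :: "('x \<Rightarrow>\<^sub>0 int) \<Rightarrow> int" where
  "augmentation c = (\<Sum>x \<in> Poly_Mapping.keys c. Poly_Mapping.lookup c x)"

definition Z0 :: "('a, 'c) ring_scheme \<Rightarrow> (('a mat \<times> 'a mat) set \<Rightarrow>\<^sub>0 int) set" where
  "Z0 R = kernel (Q R 0) integer_group augmentation"

definition B0 :: "('a, 'c) ring_scheme \<Rightarrow> (('a mat \<times> 'a mat) set \<Rightarrow>\<^sub>0 int) set" where
  "B0 R = boundary R 1 ` carrier (Q R 1)"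

definition H0 :: "('a, 'c) ring_scheme \<Rightarrow> (('a mat \<times> 'a mat) set \<Rightarrow>\<^sub>0 int) set monoid" where
  "H0 R = (Q R 0)\<lparr>carrier := Z0 R\<rparr> Mod B0 R"

section \<open>Induced maps\<close>

definition free_map :: "('b, 'd) ring_scheme \<Rightarrow> ('a \<Rightarrow> 'b)
    \<Rightarrow> (('a mat \<times> 'a mat) set \<Rightarrow>\<^sub>0 int) \<Rightarrow> (('b mat \<times> 'b mat) set \<Rightarrow>\<^sub>0 int)" where
  "free_map S f = frag_extend (\<lambda>X. frag_of (L_map S 1 f X))"

definition G0_map :: "('b, 'd) ring_scheme \<Rightarrow> ('a \<Rightarrow> 'b)
    \<Rightarrow> (('a mat \<times> 'a mat) set \<Rightarrow>\<^sub>0 int) set \<Rightarrow> (('b mat \<times> 'b mat) set \<Rightarrow>\<^sub>0 int) set" where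
  "G0_map S f = quotient_map (free_Abelian_group (L S 1)) (G0_kernel S) (free_map S f)"

definition H0_map :: "('b, 'd) ring_scheme \<Rightarrow> ('a \<Rightarrow> 'b)
    \<Rightarrow> (('a mat \<times> 'a mat) set \<Rightarrow>\<^sub>0 int) set \<Rightarrow> (('b mat \<times> 'b mat) set \<Rightarrow>\<^sub>0 int) set" where
  "H0_map S f = quotient_map ((Q S 0)\<lparr>carrier := Z0 S\<rparr>) (B0 S) (free_map S f)"

definition G0_class :: "('a, 'c) ring_scheme \<Rightarrow> (('a mat \<times> 'a mat) set \<Rightarrow>\<^sub>0 int)
    \<Rightarrow> (('a mat \<times> 'a mat) set \<Rightarrow>\<^sub>0 int) set" where
  "G0_class R x = G0_kernel R #>\<^bsub>free_Abelian_group (L R 1)\<^esub> x"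

definition H0_class :: "('a, 'c) ring_scheme \<Rightarrow> (('a mat \<times> 'a mat) set \<Rightarrow>\<^sub>0 int)
    \<Rightarrow> (('a mat \<times> 'a mat) set \<Rightarrow>\<^sub>0 int) set" where
  "H0_class R z = B0 R #>\<^bsub>(Q R 0)\<lparr>carrier := Z0 R\<rparr>\<^esub> z"

definition lambda_map :: "('a, 'c) ring_scheme
    \<Rightarrow> (('a mat \<times> 'a mat) set \<Rightarrow>\<^sub>0 int) set \<Rightarrow> (('a mat \<times> 'a mat) set \<Rightarrow>\<^sub>0 int) set" where
  "lambda_map R = quotient_map ((Q R 0)\<lparr>carrier := Z0 R\<rparr>) (B0 R)
     (frag_extend (\<lambda>X. frag_of X - frag_of (L_zero R)))"

end

theory Submission
  imports Defs "HOL-Algebra.UnivPoly"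
begin

text \<open>
  A class in $L_2(R)$ is represented by a matrix $B$ together with two columns $A,A'$, and the boundary of
  $[B|A,A']$ is the difference of the two sides of the first defining relation of $G_0(R)$
  (\<open>boundary_class\<close>).  So the group $B_0(R)$ of boundaries is generated by exactly these
  differences, the exchange relators (\<open>B0_eq_generate\<close>), and $G_0(R)$ is the quotient of the
  free abelian group $Q_0(R)$ by $B_0(R)$ and the one further relator $0_1$.

  Now $\epsilon(0_1)=1$, so $Q_0(R)$ is the direct sum of $Z_0(R)$ and the infinite cyclic group
  on $0_1$, and the projection onto $Z_0(R)$ is $p(c)=c-\epsilon(c)0_1$.  As $B_0(R)$ lies in
  $Z_0(R)$, dividing $Q_0(R)$ by $B_0(R)$ and $0_1$ is the same as dividing $Z_0(R)$ by $B_0(R)$,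
  and the isomorphism is induced by $p$.  On generators $p$ is $[B|A]\mapsto[B|A]-0_1$, which is
  the rule defining $\lambda_R$.  The precise form of this argument is \<open>difference_in_B0_iff\<close>:
  $p(c)$ is a boundary exactly if $c$ is a consequence of the relations of $G_0(R)$.

  A ring morphism maps exchange relators to exchange relators and $0_1$ to $0_1$, and preserves
  $\epsilon$; hence it commutes with $p$, which gives naturality.

  What remains is that all the maps are well defined, that is, that $\le_n$ is a pre-order and
  that moving a column of $A$ into $B$, deleting a column, and applying a ring morphism to all
  entries are monotone for it.  This is matrix algebra over a possibly non-commutative ring.
\<close>

section \<open>Matrix arithmetic over a ring\<close>

lemma mats_iff:
  "M \<in> mats R m n \<longleftrightarrow>
     dim_row M = m \<and> dim_col M = n \<and> (\<forall>i<m. \<forall>j<n. M $$ (i, j) \<in> carrier R)"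
  unfolding mats_def carrier_mat_def by (auto dest!: elements_matD)

lemma mats_dim:
  assumes "M \<in> mats R m n"
  shows "dim_row M = m" and "dim_col M = n"
  using assms by (auto simp: mats_iff)

lemma mats_entry:
  "M \<in> mats R m n \<Longrightarrow> i < m \<Longrightarrow> j < n \<Longrightarrow> M $$ (i, j) \<in> carrier R"
  by (auto simp: mats_iff)

lemmas mats_simps = mats_dim mats_entry

lemma mats_eqI:
  assumes "M \<in> mats R m n" and "N \<in> mats R m n"
    and "\<And>i j. i < m \<Longrightarrow> j < n \<Longrightarrow> M $$ (i, j) = N $$ (i, j)"
  shows "M = N"
  using assms by (intro eq_matI) (auto simp: mats_simps)

text \<open>
  Witnesses for \<open>L_le\<close> are block matrices assembled from these pieces and \<open>hcat\<close>.
\<close>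

definition mzero :: "('a, 'c) ring_scheme \<Rightarrow> nat \<Rightarrow> nat \<Rightarrow> 'a mat" where
  "mzero R m n = mat m n (\<lambda>_. \<zero>\<^bsub>R\<^esub>)"

definition mone :: "('a, 'c) ring_scheme \<Rightarrow> nat \<Rightarrow> 'a mat" where
  "mone R n = mat n n (\<lambda>(i, j). if i = j then \<one>\<^bsub>R\<^esub> else \<zero>\<^bsub>R\<^esub>)"

definition vcat :: "'a mat \<Rightarrow> 'a mat \<Rightarrow> 'a mat" where
  "vcat M N = mat (dim_row M + dim_row N) (dim_col M)
     (\<lambda>(i, j). if i < dim_row M then M $$ (i, j) else N $$ (i - dim_row M, j))"

lemma hcat_mats:
  "M \<in> mats R r m \<Longrightarrow> N \<in> mats R r n \<Longrightarrow> hcat M N \<in> mats R r (m + n)"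
  by (auto simp: mats_iff hcat_def)

lemma vcat_mats:
  "M \<in> mats R k n \<Longrightarrow> N \<in> mats R l n \<Longrightarrow> vcat M N \<in> mats R (k + l) n"
  by (auto simp: mats_iff vcat_def)

lemma column_mats: "A \<in> mats R r n \<Longrightarrow> i < n \<Longrightarrow> column A i \<in> mats R r 1"
  by (auto simp: mats_iff column_def)

lemma remove_column_mats:
  "A \<in> mats R r (Suc n) \<Longrightarrow> i \<le> n \<Longrightarrow> remove_column A i \<in> mats R r n"
  by (auto simp: mats_iff remove_column_def)

lemma (in ring) finsum_swap:
  assumes "finite A" and "finite B" and "\<And>a b. a \<in> A \<Longrightarrow> b \<in> B \<Longrightarrow> f a b \<in> carrier R"
  shows "(\<Oplus>a\<in>A. \<Oplus>b\<in>B. f a b) = (\<Oplus>b\<in>B. \<Oplus>a\<in>A. f a b)"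
  using assms(1,3)
proof (induction A rule: finite_induct)
  case empty
  then show ?case by (simp add: finsum_zero)
next
  case (insert x A)
  have "(\<Oplus>b\<in>B. \<Oplus>a\<in>insert x A. f a b) = (\<Oplus>b\<in>B. f x b \<oplus> (\<Oplus>a\<in>A. f a b))"
    using insert.hyps insert.prems
    by (intro finsum_cong') (auto intro!: finsum_insert finsum_closed)
  also have "\<dots> = (\<Oplus>b\<in>B. f x b) \<oplus> (\<Oplus>b\<in>B. \<Oplus>a\<in>A. f a b)"
    using insert.prems by (intro finsum_addf) (auto intro!: finsum_closed)
  also have "\<dots> = (\<Oplus>a\<in>insert x A. \<Oplus>b\<in>B. f a b)"
    using insert assms(2) by (subst finsum_insert) (auto intro!: finsum_closed)
  finally show ?case by simp
qed

context ring
begin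

lemma mmult_mats:
  "M \<in> mats R m k \<Longrightarrow> N \<in> mats R k n \<Longrightarrow> mmult R M N \<in> mats R m n"
  by (auto simp: mats_iff mmult_def intro!: finsum_closed)

lemma mmult_entry:
  assumes "M \<in> mats R m k" and "N \<in> mats R k n" and "i < m" and "j < n"
  shows "mmult R M N $$ (i, j) = (\<Oplus>l\<in>{..<k}. M $$ (i, l) \<otimes> N $$ (l, j))"
  using assms by (auto simp: mats_iff mmult_def)

lemma madd_mats: "M \<in> mats R m n \<Longrightarrow> N \<in> mats R m n \<Longrightarrow> madd R M N \<in> mats R m n"
  by (auto simp: mats_iff madd_def)

lemma madd_entry:
  "M \<in> mats R m n \<Longrightarrow> i < m \<Longrightarrow> j < n \<Longrightarrow> madd R M N $$ (i, j) = M $$ (i, j) \<oplus> N $$ (i, j)"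
  by (auto simp: mats_iff madd_def)

lemma mzero_mats: "mzero R m n \<in> mats R m n"
  by (auto simp: mats_iff mzero_def)

lemma mone_mats: "mone R n \<in> mats R n n"
  by (auto simp: mats_iff mone_def)

lemma madd_assoc:
  assumes "M \<in> mats R m n" and "N \<in> mats R m n" and "P \<in> mats R m n"
  shows "madd R (madd R M N) P = madd R M (madd R N P)"
  using assms by (intro eq_matI) (auto simp: madd_def mats_iff a_assoc)

lemma madd_comm:
  assumes "M \<in> mats R m n" and "N \<in> mats R m n"
  shows "madd R M N = madd R N M"
  using assms by (intro eq_matI) (auto simp: madd_def mats_iff a_comm)

lemma madd_mzero:
  assumes "M \<in> mats R m n"
  shows "madd R M (mzero R m n) = M"
  using assms by (intro eq_matI) (auto simp: madd_def mzero_def mats_iff)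

lemma mmult_mzero:
  assumes "M \<in> mats R m k"
  shows "mmult R M (mzero R k n) = mzero R m n"
proof (rule mats_eqI[where m = m and n = n and R = R])
  fix i j assume ij: "i < m" "j < n"
  have "mmult R M (mzero R k n) $$ (i, j) = (\<Oplus>l\<in>{..<k}. \<zero>)"
    unfolding mmult_entry[OF assms mzero_mats ij]
    using assms ij by (intro finsum_cong') (auto simp: mats_simps mzero_def)
  then show "mmult R M (mzero R k n) $$ (i, j) = mzero R m n $$ (i, j)"
    using ij by (simp add: mzero_def finsum_zero)
qed (auto intro!: mmult_mats mzero_mats assms)

lemma mmult_assoc:
  assumes M: "M \<in> mats R m k" and N: "N \<in> mats R k l" and P: "P \<in> mats R l n"
  shows "mmult R (mmult R M N) P = mmult R M (mmult R N P)"
proof (rule mats_eqI[where m = m and n = n and R = R])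
  fix i j assume ij: "i < m" "j < n"
  have "mmult R (mmult R M N) P $$ (i, j)
      = (\<Oplus>b\<in>{..<l}. (\<Oplus>a\<in>{..<k}. M $$ (i, a) \<otimes> N $$ (a, b)) \<otimes> P $$ (b, j))"
    unfolding mmult_entry[OF mmult_mats[OF M N] P ij]
    using M N P ij by (intro finsum_cong') (auto simp: mats_simps mmult_entry intro!: finsum_closed)
  also have "\<dots> = (\<Oplus>b\<in>{..<l}. \<Oplus>a\<in>{..<k}. M $$ (i, a) \<otimes> (N $$ (a, b) \<otimes> P $$ (b, j)))"
    using M N P ij
    by (intro finsum_cong')
      (auto simp: mats_simps finsum_ldistr m_assoc intro!: finsum_closed finsum_cong')
  also have "\<dots> = (\<Oplus>a\<in>{..<k}. \<Oplus>b\<in>{..<l}. M $$ (i, a) \<otimes> (N $$ (a, b) \<otimes> P $$ (b, j)))"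
    using M N P ij by (intro finsum_swap) (auto simp: mats_simps)
  also have "\<dots> = (\<Oplus>a\<in>{..<k}. M $$ (i, a) \<otimes> (\<Oplus>b\<in>{..<l}. N $$ (a, b) \<otimes> P $$ (b, j)))"
    using M N P ij
    by (intro finsum_cong') (auto simp: mats_simps finsum_rdistr intro!: finsum_closed)
  also have "\<dots> = mmult R M (mmult R N P) $$ (i, j)"
    unfolding mmult_entry[OF M mmult_mats[OF N P] ij]
    using M N P ij by (intro finsum_cong') (auto simp: mats_simps mmult_entry intro!: finsum_closed)
  finally show "mmult R (mmult R M N) P $$ (i, j) = mmult R M (mmult R N P) $$ (i, j)" .
qed (auto intro!: mmult_mats assms)

lemma mmult_madd:
  assumes M: "M \<in> mats R m k" and N: "N \<in> mats R k n" and P: "P \<in> mats R k n"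
  shows "mmult R M (madd R N P) = madd R (mmult R M N) (mmult R M P)"
proof (rule mats_eqI[where m = m and n = n and R = R])
  fix i j assume ij: "i < m" "j < n"
  have "mmult R M (madd R N P) $$ (i, j)
      = (\<Oplus>a\<in>{..<k}. M $$ (i, a) \<otimes> N $$ (a, j) \<oplus> M $$ (i, a) \<otimes> P $$ (a, j))"
    unfolding mmult_entry[OF M madd_mats[OF N P] ij]
    using M N P ij by (intro finsum_cong') (auto simp: mats_simps madd_entry r_distr)
  also have "\<dots> = mmult R M N $$ (i, j) \<oplus> mmult R M P $$ (i, j)"
    using M N P ij by (auto simp: mats_simps mmult_entry intro!: finsum_addf)
  finally show "mmult R M (madd R N P) $$ (i, j) = madd R (mmult R M N) (mmult R M P) $$ (i, j)"
    using M N P ij by (simp add: madd_entry[OF mmult_mats[OF M N] ij])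
qed (auto intro!: mmult_mats madd_mats assms)

lemma finsum_delta:
  assumes "finite A" and "i \<in> A" and "f i \<in> carrier R"
  shows "(\<Oplus>a\<in>A. if a = i then f a else \<zero>) = f i"
proof -
  have "(\<Oplus>a\<in>A. if a = i then f a else \<zero>) = (\<Oplus>a\<in>A. if i = a then f i else \<zero>)"
    using assms by (intro finsum_cong') (auto simp: mats_simps)
  then show ?thesis
    using finsum_singleton[of i A "\<lambda>_. f i"] assms by simp
qed

lemma mone_mmult:
  assumes M: "M \<in> mats R m n"
  shows "mmult R (mone R m) M = M"
proof (rule mats_eqI[where m = m and n = n and R = R])
  fix i j assume ij: "i < m" "j < n"
  have "mmult R (mone R m) M $$ (i, j) = (\<Oplus>a\<in>{..<m}. if a = i then M $$ (a, j) else \<zero>)"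
    unfolding mmult_entry[OF mone_mats M ij]
    using M ij by (intro finsum_cong') (auto simp: mats_simps mone_def)
  also have "\<dots> = M $$ (i, j)" using M ij by (intro finsum_delta) (auto simp: mats_simps)
  finally show "mmult R (mone R m) M $$ (i, j) = M $$ (i, j)" .
qed (auto intro!: mmult_mats mone_mats assms)

lemma mmult_mone:
  assumes M: "M \<in> mats R m n"
  shows "mmult R M (mone R n) = M"
proof (rule mats_eqI[where m = m and n = n and R = R])
  fix i j assume ij: "i < m" "j < n"
  have "mmult R M (mone R n) $$ (i, j) = (\<Oplus>a\<in>{..<n}. if a = j then M $$ (i, a) else \<zero>)"
    unfolding mmult_entry[OF M mone_mats ij]
    using M ij by (intro finsum_cong') (auto simp: mats_simps mone_def)
  also have "\<dots> = M $$ (i, j)" using M ij by (intro finsum_delta) (auto simp: mats_simps)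
  finally show "mmult R M (mone R n) $$ (i, j) = M $$ (i, j)" .
qed (auto intro!: mmult_mats mone_mats assms)

lemma mmult_hcat:
  assumes M: "M \<in> mats R m k" and N: "N \<in> mats R k n" and P: "P \<in> mats R k p"
  shows "mmult R M (hcat N P) = hcat (mmult R M N) (mmult R M P)"
  using assms by (intro eq_matI) (auto simp: mmult_def hcat_def mats_iff intro!: finsum_cong')

lemma madd_hcat:
  assumes "M \<in> mats R m n" and "N \<in> mats R m n" and "P \<in> mats R m p" and "T \<in> mats R m p"
  shows "madd R (hcat M P) (hcat N T) = hcat (madd R M N) (madd R P T)"
  using assms by (intro eq_matI) (auto simp: madd_def hcat_def mats_iff)

lemma mmult_vcat:
  assumes M: "M \<in> mats R m k" and N: "N \<in> mats R m l"
    and P: "P \<in> mats R k n" and T: "T \<in> mats R l n"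
  shows "mmult R (hcat M N) (vcat P T) = madd R (mmult R M P) (mmult R N T)"
proof (rule mats_eqI[where m = m and n = n and R = R])
  fix i j assume ij: "i < m" "j < n"
  let ?f = "\<lambda>a. hcat M N $$ (i, a) \<otimes> vcat P T $$ (a, j)"
  have f: "?f a = M $$ (i, a) \<otimes> P $$ (a, j)" if "a < k" for a
    using that ij assms by (simp add: hcat_def vcat_def mats_simps)
  have g: "?f (a + k) = N $$ (i, a) \<otimes> T $$ (a, j)" if "a < l" for a
    using that ij assms by (simp add: hcat_def vcat_def mats_simps)
  have closed: "?f a \<in> carrier R" if "a < k + l" for a
    using that ij hcat_mats[OF M N] vcat_mats[OF P T] by (auto simp: mats_simps)
  have split: "{..<k + l} = {..<k} \<union> {k..<k + l}"
    by (auto simp: mats_simps)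
  have shift: "{k..<k + l} = (\<lambda>a. a + k) ` {..<l}"
    by (simp add: lessThan_atLeast0 add.commute)
  have "mmult R (hcat M N) (vcat P T) $$ (i, j) = (\<Oplus>a\<in>{..<k + l}. ?f a)"
    by (rule mmult_entry[OF hcat_mats[OF M N] vcat_mats[OF P T] ij])
  also have "\<dots> = (\<Oplus>a\<in>{..<k}. ?f a) \<oplus> (\<Oplus>a\<in>{k..<k + l}. ?f a)"
    unfolding split by (rule finsum_Un_disjoint) (auto simp: mats_simps intro!: closed)
  also have "(\<Oplus>a\<in>{k..<k + l}. ?f a) = (\<Oplus>a\<in>{..<l}. ?f (a + k))"
    unfolding shift by (rule finsum_reindex) (auto simp: mats_simps intro!: closed)
  also have "\<dots> = mmult R N T $$ (i, j)"
    unfolding mmult_entry[OF N T ij] using N T ij by (intro finsum_cong') (auto simp: mats_simps g)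
  also have "(\<Oplus>a\<in>{..<k}. ?f a) = mmult R M P $$ (i, j)"
    unfolding mmult_entry[OF M P ij] using M P ij by (intro finsum_cong') (auto simp: mats_simps f)
  finally show "mmult R (hcat M N) (vcat P T) $$ (i, j)
      = madd R (mmult R M P) (mmult R N T) $$ (i, j)"
    by (simp add: madd_entry[OF mmult_mats[OF M P] ij])
qed (auto intro!: mmult_mats madd_mats hcat_mats vcat_mats assms)

lemma mmult_column:
  "M \<in> mats R m k \<Longrightarrow> N \<in> mats R k n \<Longrightarrow> i < n \<Longrightarrow>
   mmult R M (column N i) = column (mmult R M N) i"
  by (intro eq_matI) (auto simp: mmult_def column_def mats_iff intro!: finsum_cong')

lemma madd_column:
  "M \<in> mats R m n \<Longrightarrow> N \<in> mats R m n \<Longrightarrow> i < n \<Longrightarrow>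
   madd R (column M i) (column N i) = column (madd R M N) i"
  by (intro eq_matI) (auto simp: madd_def column_def mats_iff)

lemma mmult_remove_column:
  "M \<in> mats R m k \<Longrightarrow> N \<in> mats R k (Suc n) \<Longrightarrow> i \<le> n \<Longrightarrow>
   mmult R M (remove_column N i) = remove_column (mmult R M N) i"
  by (intro eq_matI) (auto simp: mmult_def remove_column_def mats_iff intro!: finsum_cong')

lemma madd_remove_column:
  "M \<in> mats R m (Suc n) \<Longrightarrow> N \<in> mats R m (Suc n) \<Longrightarrow> i \<le> n \<Longrightarrow>
   madd R (remove_column M i) (remove_column N i) = remove_column (madd R M N) i"
  by (intro eq_matI) (auto simp: madd_def remove_column_def mats_iff)

end

lemma map_mat_mats:
  "f \<in> ring_hom R S \<Longrightarrow> M \<in> mats R m n \<Longrightarrow> map_mat f M \<in> mats S m n"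
  by (auto simp: mats_iff ring_hom_closed)

context ring_hom_ring
begin

lemma map_mat_mmult:
  assumes "M \<in> mats R m k" and "N \<in> mats R k n"
  shows "map_mat h (mmult R M N) = mmult S (map_mat h M) (map_mat h N)"
  using assms
  by (intro eq_matI)
    (auto simp: mmult_def mats_iff Pi_def intro!: S.finsum_cong' S.finsum_closed)

lemma map_mat_madd:
  assumes "M \<in> mats R m n" and "N \<in> mats R m n"
  shows "map_mat h (madd R M N) = madd S (map_mat h M) (map_mat h N)"
  using assms by (intro eq_matI) (auto simp: madd_def mats_iff)

end

lemma map_mat_hcat:
  "dim_row M = dim_row N \<Longrightarrow> map_mat f (hcat M N) = hcat (map_mat f M) (map_mat f N)"
  by (intro eq_matI) (auto simp: mats_simps hcat_def)

section \<open>The classes in $L_n(R)$ and the maps between them\<close>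

lemma L_pre_iff: "(B, A) \<in> L_pre R n \<longleftrightarrow> (\<exists>r m. B \<in> mats R r m \<and> A \<in> mats R r n)"
  by (simp add: L_pre_def)

lemma L_le_iff:
  assumes "B \<in> mats R r m" and "B' \<in> mats R r' m'"
  shows "L_le R n (B, A) (B', A') \<longleftrightarrow>
    (\<exists>U\<in>mats R r' r. \<exists>V\<in>mats R m' m. \<exists>G\<in>mats R m' n.
       mmult R U B = mmult R B' V \<and> mmult R U A = madd R A' (mmult R B' G))"
  using assms by (simp add: L_le_def mats_dim)

context ring
begin

lemma L_le_refl:
  assumes "x \<in> L_pre R n"
  shows "L_le R n x x"
proof -
  obtain B A r m where x: "x = (B, A)" and B: "B \<in> mats R r m" and A: "A \<in> mats R r n"
    using assms by (cases x) (auto simp: L_pre_iff)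
  have "mmult R (mone R r) B = mmult R B (mone R m)"
    and "mmult R (mone R r) A = madd R A (mmult R B (mzero R m n))"
    using A B by (simp_all add: mone_mmult mmult_mone mmult_mzero madd_mzero)
  then show ?thesis
    unfolding x L_le_iff[OF B B] using mone_mats mzero_mats by blast
qed

text \<open>
  Witnesses $(U,V,G)$ and $(U',V',G')$ compose to $(U'U, V'V, G'+V'G)$, because
  $U'UA=U'A'+U'B'G=A''+B''G'+B''V'G$.
\<close>

lemma L_le_trans:
  assumes "x \<in> L_pre R n" and "y \<in> L_pre R n" and "z \<in> L_pre R n"
    and "L_le R n x y" and "L_le R n y z"
  shows "L_le R n x z"
proof -
  obtain B A r m where x: "x = (B, A)" and B: "B \<in> mats R r m" and A: "A \<in> mats R r n"
    using assms(1) by (cases x) (auto simp: L_pre_iff)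
  obtain B' A' r' m' where y: "y = (B', A')" and B': "B' \<in> mats R r' m'" and A': "A' \<in> mats R r' n"
    using assms(2) by (cases y) (auto simp: L_pre_iff)
  obtain B'' A'' r'' m'' where z: "z = (B'', A'')"
    and B'': "B'' \<in> mats R r'' m''" and A'': "A'' \<in> mats R r'' n"
    using assms(3) by (cases z) (auto simp: L_pre_iff)
  obtain U V G where U: "U \<in> mats R r' r" and V: "V \<in> mats R m' m" and G: "G \<in> mats R m' n"
    and UB: "mmult R U B = mmult R B' V" and UA: "mmult R U A = madd R A' (mmult R B' G)"
    using assms(4) unfolding x y L_le_iff[OF B B'] by blast
  obtain U' V' G' where U': "U' \<in> mats R r'' r'" and V': "V' \<in> mats R m'' m'"
    and G': "G' \<in> mats R m'' n"
    and UB': "mmult R U' B' = mmult R B'' V'"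
    and UA': "mmult R U' A' = madd R A'' (mmult R B'' G')"
    using assms(5) unfolding y z L_le_iff[OF B' B''] by blast
  have "mmult R (mmult R U' U) B = mmult R (mmult R U' B') V"
    by (simp add: mmult_assoc[OF U' U B] UB mmult_assoc[OF U' B' V])
  also have "\<dots> = mmult R B'' (mmult R V' V)"
    by (simp add: UB' mmult_assoc[OF B'' V' V])
  finally have first: "mmult R (mmult R U' U) B = mmult R B'' (mmult R V' V)" .
  have "mmult R (mmult R U' U) A = madd R (mmult R U' A') (mmult R (mmult R U' B') G)"
    by (simp add: mmult_assoc[OF U' U A] UA mmult_madd[OF U' A' mmult_mats[OF B' G]]
        mmult_assoc[OF U' B' G])
  also have "\<dots> = madd R (madd R A'' (mmult R B'' G')) (mmult R B'' (mmult R V' G))"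
    by (simp add: UA' UB' mmult_assoc[OF B'' V' G])
  also have "\<dots> = madd R A'' (mmult R B'' (madd R G' (mmult R V' G)))"
    by (simp add: mmult_madd[OF B'' G' mmult_mats[OF V' G]] madd_assoc[OF A''
        mmult_mats[OF B'' G'] mmult_mats[OF B'' mmult_mats[OF V' G]]])
  finally have second: "mmult R (mmult R U' U) A
      = madd R A'' (mmult R B'' (madd R G' (mmult R V' G)))" .
  show ?thesis
    unfolding x z L_le_iff[OF B B'']
    using first second mmult_mats[OF U' U] mmult_mats[OF V' V]
      madd_mats[OF G' mmult_mats[OF V' G]] by blast
qed

lemma equiv_L_equiv: "equiv (L_pre R n) (L_equiv R n)"
proof (rule equivI)
  show "refl_on (L_pre R n) (L_equiv R n)"
    unfolding refl_on_def L_equiv_def using L_le_refl by auto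
  show "sym (L_equiv R n)"
    unfolding sym_def L_equiv_def by auto
  show "trans (L_equiv R n)"
  proof (rule transI)
    fix x y z assume "(x, y) \<in> L_equiv R n" and "(y, z) \<in> L_equiv R n"
    then show "(x, z) \<in> L_equiv R n"
      using L_le_trans[of x n y z] L_le_trans[of z n y x] by (simp add: L_equiv_def)
  qed
  show "L_equiv R n \<subseteq> L_pre R n \<times> L_pre R n"
    unfolding L_equiv_def by auto
qed

lemma L_class_in_L: "x \<in> L_pre R n \<Longrightarrow> L_class R n x \<in> L R n"
  unfolding L_class_def L_def by (rule quotientI)

lemma L_cases:
  assumes "X \<in> L R n"
  obtains B A r m where "X = L_class R n (B, A)" and "B \<in> mats R r m" and "A \<in> mats R r n"
  using assms unfolding L_def L_class_def quotient_def by (auto simp: L_pre_iff)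

lemma L_class_eqI:
  assumes "x \<in> L_pre R n" and "y \<in> L_pre R n" and "L_le R n x y" and "L_le R n y x"
  shows "L_class R n x = L_class R n y"
  unfolding L_class_def
  by (rule equiv_class_eq[OF equiv_L_equiv]) (use assms in \<open>auto simp: L_equiv_def\<close>)

lemma L_class_self: "x \<in> L_pre R n \<Longrightarrow> x \<in> L_class R n x"
  unfolding L_class_def by (rule equiv_class_self[OF equiv_L_equiv])

text \<open>
  A map on pairs that preserves the pre-order descends to classes; the maps \<open>L_E\<close>, \<open>L_N\<close>
  and \<open>L_map\<close> are all of this kind.
\<close>

lemma the_elem_L_class:
  assumes "ring S"
    and pre: "\<And>B A. (B, A) \<in> L_pre R n \<Longrightarrow> T B A \<in> L_pre S k"
    and mono: "\<And>B A B' A'. (B, A) \<in> L_pre R n \<Longrightarrow> (B', A') \<in> L_pre R n \<Longrightarrow>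
        L_le R n (B, A) (B', A') \<Longrightarrow> L_le S k (T B A) (T B' A')"
    and x: "(B, A) \<in> L_pre R n"
  shows "the_elem ((\<lambda>(B, A). L_class S k (T B A)) ` L_class R n (B, A)) = L_class S k (T B A)"
proof -
  interpret S: ring S by fact
  have "L_class S k (T B' A') = L_class S k (T B A)"
    if "(B', A') \<in> L_class R n (B, A)" for B' A'
    using that x pre mono unfolding L_class_def
    by (intro S.L_class_eqI[unfolded L_class_def]) (auto simp: L_equiv_def)
  moreover have "L_class R n (B, A) \<noteq> {}"
    using L_class_self[OF x] by blast
  ultimately show ?thesis
    using the_elem_image_unique[of "L_class R n (B, A)" "\<lambda>(B, A). L_class S k (T B A)"
        "L_class S k (T B A)"]
    by (simp add: case_prod_beta')
qed

lemma L_le_remove_column: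
  assumes "(B, A) \<in> L_pre R (Suc n)" and "(B', A') \<in> L_pre R (Suc n)" and i: "i \<le> n"
    and le: "L_le R (Suc n) (B, A) (B', A')"
  shows "L_le R n (B, remove_column A i) (B', remove_column A' i)"
proof -
  obtain r m where B: "B \<in> mats R r m" and A: "A \<in> mats R r (Suc n)"
    using assms(1) by (auto simp: L_pre_iff)
  obtain r' m' where B': "B' \<in> mats R r' m'" and A': "A' \<in> mats R r' (Suc n)"
    using assms(2) by (auto simp: L_pre_iff)
  obtain U V G where U: "U \<in> mats R r' r" and V: "V \<in> mats R m' m" and G: "G \<in> mats R m' (Suc n)"
    and UB: "mmult R U B = mmult R B' V" and UA: "mmult R U A = madd R A' (mmult R B' G)"
    using le unfolding L_le_iff[OF B B'] by blast
  have "mmult R U (remove_column A i)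
      = madd R (remove_column A' i) (mmult R B' (remove_column G i))"
    by (simp add: mmult_remove_column[OF U A i] mmult_remove_column[OF B' G i] UA
        madd_remove_column[OF A' mmult_mats[OF B' G] i])
  then show ?thesis
    unfolding L_le_iff[OF B B'] using U V UB remove_column_mats[OF G i] by blast
qed

text \<open>
  Let $UB=B'V$ and $UA=A'+B'G$, and split $G$ into its $i$-th column $g$ and the matrix $H$ of
  its other columns.  Then $UA_i=A'_i+B'g$, so the witness $V$ has to be bordered by $g$ on the
  right and by the row $(0,1)$ below to give $U(B,A_i)=(B',A'_i)V'$.  For the other columns the
  witness is $H$ with a zero row below, whose zeros cancel the column $A'_i$ added to $B'$.
\<close>

lemma L_le_move_column:
  assumes "(B, A) \<in> L_pre R (Suc n)" and "(B', A') \<in> L_pre R (Suc n)" and i: "i \<le> n"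
    and le: "L_le R (Suc n) (B, A) (B', A')"
  shows "L_le R n (hcat B (column A i), remove_column A i)
    (hcat B' (column A' i), remove_column A' i)"
proof -
  obtain r m where B: "B \<in> mats R r m" and A: "A \<in> mats R r (Suc n)"
    using assms(1) by (auto simp: L_pre_iff)
  obtain r' m' where B': "B' \<in> mats R r' m'" and A': "A' \<in> mats R r' (Suc n)"
    using assms(2) by (auto simp: L_pre_iff)
  obtain U V G where U: "U \<in> mats R r' r" and V: "V \<in> mats R m' m" and G: "G \<in> mats R m' (Suc n)"
    and UB: "mmult R U B = mmult R B' V" and UA: "mmult R U A = madd R A' (mmult R B' G)"
    using le unfolding L_le_iff[OF B B'] by blast
  have i': "i < Suc n" using i by simp
  note a = column_mats[OF A i'] and a' = column_mats[OF A' i'] and g = column_mats[OF G i']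
  note rA' = remove_column_mats[OF A' i] and rG = remove_column_mats[OF G i]
  define V' where "V' = vcat (hcat V (column G i)) (hcat (mzero R 1 m) (mone R 1))"
  define G' where "G' = vcat (remove_column G i) (mzero R 1 n)"
  note top = hcat_mats[OF V g] and bottom = hcat_mats[OF mzero_mats[of 1 m] mone_mats[of 1]]
  have V': "V' \<in> mats R (m' + 1) (m + 1)"
    unfolding V'_def by (rule vcat_mats[OF top bottom])
  have G': "G' \<in> mats R (m' + 1) n"
    unfolding G'_def by (rule vcat_mats[OF rG mzero_mats])
  have "mmult R (hcat B' (column A' i)) V'
      = madd R (hcat (mmult R B' V) (mmult R B' (column G i)))
          (hcat (mzero R r' m) (column A' i))"
    unfolding V'_def
    by (simp del: One_nat_def add: mmult_vcat[OF B' a' top bottom] mmult_hcat[OF B' V g]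
        mmult_hcat[OF a' mzero_mats mone_mats] mmult_mzero[OF a'] mmult_mone[OF a'])
  also have "\<dots> = hcat (mmult R B' V) (madd R (column A' i) (mmult R B' (column G i)))"
    by (simp add: madd_hcat[OF mmult_mats[OF B' V] mzero_mats mmult_mats[OF B' g] a']
        madd_mzero[OF mmult_mats[OF B' V]] madd_comm[OF mmult_mats[OF B' g] a'])
  also have "\<dots> = mmult R U (hcat B (column A i))"
    by (simp add: mmult_hcat[OF U B a] UB mmult_column[OF U A i'] UA
        mmult_column[OF B' G i'] madd_column[OF A' mmult_mats[OF B' G] i'])
  finally have first: "mmult R U (hcat B (column A i)) = mmult R (hcat B' (column A' i)) V'"
    by simp
  have "mmult R (hcat B' (column A' i)) G' = mmult R B' (remove_column G i)"
    unfolding G'_def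
    by (simp del: One_nat_def add: mmult_vcat[OF B' a' rG mzero_mats] mmult_mzero[OF a']
        madd_mzero[OF mmult_mats[OF B' rG]])
  then have second: "mmult R U (remove_column A i)
      = madd R (remove_column A' i) (mmult R (hcat B' (column A' i)) G')"
    by (simp add: mmult_remove_column[OF U A i] mmult_remove_column[OF B' G i] UA
        madd_remove_column[OF A' mmult_mats[OF B' G] i])
  show ?thesis
    unfolding L_le_iff[OF hcat_mats[OF B a] hcat_mats[OF B' a']]
    using U V' G' first second by blast
qed

lemma L_pre_remove_column:
  "(B, A) \<in> L_pre R (Suc n) \<Longrightarrow> i \<le> n \<Longrightarrow> (B, remove_column A i) \<in> L_pre R n"
  by (auto simp: L_pre_iff intro: remove_column_mats)

lemma L_pre_move_column:
  assumes "(B, A) \<in> L_pre R (Suc n)" and "i \<le> n"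
  shows "(hcat B (column A i), remove_column A i) \<in> L_pre R n"
proof -
  obtain r m where "B \<in> mats R r m" and "A \<in> mats R r (Suc n)"
    using assms(1) by (auto simp: L_pre_iff)
  then show ?thesis
    unfolding L_pre_iff using assms(2)
    by (intro exI[of _ r] exI[of _ "m + 1"] conjI hcat_mats column_mats remove_column_mats) auto
qed

lemma L_N_class:
  assumes "(B, A) \<in> L_pre R (Suc n)" and "i \<le> n"
  shows "L_N R n i (L_class R (Suc n) (B, A)) = L_class R n (B, remove_column A i)"
  unfolding L_N_def
  by (rule the_elem_L_class[where T = "\<lambda>B A. (B, remove_column A i)"])
    (use assms L_le_remove_column L_pre_remove_column ring_axioms in auto)

lemma L_E_class:
  assumes "(B, A) \<in> L_pre R (Suc n)" and "i \<le> n"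
  shows "L_E R n i (L_class R (Suc n) (B, A))
    = L_class R n (hcat B (column A i), remove_column A i)"
  unfolding L_E_def
  by (rule the_elem_L_class[where T = "\<lambda>B A. (hcat B (column A i), remove_column A i)"])
    (use assms L_le_move_column L_pre_move_column ring_axioms in auto)

lemma L_zero_in_L: "L_zero R \<in> L R 1"
  unfolding L_zero_def by (rule L_class_in_L) (auto simp: L_pre_iff mats_iff)

end

context ring_hom_ring
begin

lemma L_le_map_mat:
  assumes "(B, A) \<in> L_pre R n" and "(B', A') \<in> L_pre R n" and le: "L_le R n (B, A) (B', A')"
  shows "L_le S n (map_mat h B, map_mat h A) (map_mat h B', map_mat h A')"
proof -
  obtain r m where B: "B \<in> mats R r m" and A: "A \<in> mats R r n"
    using assms(1) by (auto simp: L_pre_iff)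
  obtain r' m' where B': "B' \<in> mats R r' m'" and A': "A' \<in> mats R r' n"
    using assms(2) by (auto simp: L_pre_iff)
  obtain U V G where U: "U \<in> mats R r' r" and V: "V \<in> mats R m' m" and G: "G \<in> mats R m' n"
    and UB: "mmult R U B = mmult R B' V" and UA: "mmult R U A = madd R A' (mmult R B' G)"
    using le unfolding L_le_iff[OF B B'] by blast
  note map_mats = map_mat_mats[OF homh]
  have "mmult S (map_mat h U) (map_mat h B) = mmult S (map_mat h B') (map_mat h V)"
    by (simp add: map_mat_mmult[OF U B, symmetric] map_mat_mmult[OF B' V, symmetric] UB)
  moreover have "mmult S (map_mat h U) (map_mat h A)
      = madd S (map_mat h A') (mmult S (map_mat h B') (map_mat h G))"
    by (simp add: map_mat_mmult[OF U A, symmetric] map_mat_mmult[OF B' G, symmetric]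
        map_mat_madd[OF A' R.mmult_mats[OF B' G], symmetric] UA)
  ultimately show ?thesis
    unfolding L_le_iff[OF map_mats[OF B] map_mats[OF B']]
    using map_mats[OF U] map_mats[OF V] map_mats[OF G] by blast
qed

lemma map_mat_L_pre: "(B, A) \<in> L_pre R n \<Longrightarrow> (map_mat h B, map_mat h A) \<in> L_pre S n"
  by (auto simp: L_pre_iff intro: map_mat_mats[OF homh])

lemma L_map_class:
  assumes "(B, A) \<in> L_pre R n"
  shows "L_map S n h (L_class R n (B, A)) = L_class S n (map_mat h B, map_mat h A)"
  unfolding L_map_def
  by (intro R.the_elem_L_class[where T = "\<lambda>B A. (map_mat h B, map_mat h A)"]
      S.ring_axioms map_mat_L_pre L_le_map_mat assms)

lemma L_map_in_L:
  assumes "X \<in> L R n"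
  shows "L_map S n h X \<in> L S n"
proof -
  obtain B A where "X = L_class R n (B, A)" and "(B, A) \<in> L_pre R n"
    using assms by (elim R.L_cases) (auto simp: L_pre_iff)
  then show ?thesis
    by (simp add: L_map_class map_mat_L_pre S.L_class_in_L)
qed

lemma L_map_L_zero: "L_map S 1 h (L_zero R) = L_zero S"
proof -
  have "(mat 1 1 (\<lambda>_. \<zero>), mat 1 1 (\<lambda>_. \<one>)) \<in> L_pre R 1"
    by (auto simp: L_pre_iff mats_iff)
  moreover have "map_mat h (mat 1 1 (\<lambda>_. \<zero>)) = mat 1 1 (\<lambda>_. \<zero>\<^bsub>S\<^esub>)"
    and "map_mat h (mat 1 1 (\<lambda>_. \<one>)) = mat 1 1 (\<lambda>_. \<one>\<^bsub>S\<^esub>)"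
    by (auto intro!: eq_matI)
  ultimately show ?thesis
    unfolding L_zero_def by (simp add: L_map_class)
qed

end

section \<open>Free abelian groups and quotient groups\<close>

lemma subgroup_free_diff:
  assumes "subgroup H (free_Abelian_group T)" and "x \<in> H" and "y \<in> H"
  shows "x - y \<in> H"
proof -
  have "Poly_Mapping.keys y \<subseteq> T"
    using subgroup.mem_carrier[OF assms(1,3)] by simp
  then show ?thesis
    using subgroup.m_closed[OF assms(1,2) subgroup.m_inv_closed[OF assms(1,3)]] by simp
qed

lemma subgroup_free_cmul:
  assumes "subgroup H (free_Abelian_group T)" and "x \<in> H"
  shows "frag_cmul n x \<in> H"
  by (rule frag_closure_minus_cmul[where P = "\<lambda>c. c \<in> H"])
    (use subgroup.one_closed[OF assms(1)] subgroup_free_diff[OF assms(1)] assms(2) in auto)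

lemma frag_extend_in_subgroup:
  assumes H: "subgroup H (free_Abelian_group T)"
    and f: "\<And>x. x \<in> S \<Longrightarrow> f x \<in> H"
    and c: "c \<in> carrier (free_Abelian_group S)"
  shows "frag_extend f c \<in> H"
proof -
  have "Poly_Mapping.keys c \<subseteq> S" using c by simp
  then show ?thesis
    by (rule free_Abelian_group_induct[where P = "\<lambda>c. frag_extend f c \<in> H"])
      (use subgroup.one_closed[OF H] f in
        \<open>auto simp: frag_extend_diff intro: subgroup_free_diff[OF H]\<close>)
qed

lemma frag_extend_hom:
  assumes "\<And>x. x \<in> S \<Longrightarrow> f x \<in> carrier (free_Abelian_group T)"
  shows "frag_extend f \<in> hom (free_Abelian_group S) (free_Abelian_group T)"
  by (rule homI, rule frag_extend_in_subgroup[OF group.subgroup_self[OF group_free_Abelian_group]])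
    (simp_all add: assms frag_extend_add del: carrier_free_Abelian_group_iff)

lemma augmentation_simps [simp]:
  "augmentation 0 = 0" "augmentation (frag_of x) = 1"
  by (simp_all add: augmentation_def)

lemma augmentation_add: "augmentation (a + b) = augmentation a + augmentation b"
proof -
  let ?K = "Poly_Mapping.keys a \<union> Poly_Mapping.keys b"
  have eq: "augmentation c = (\<Sum>x\<in>?K. Poly_Mapping.lookup c x)"
    if "Poly_Mapping.keys c \<subseteq> ?K" for c :: "'a \<Rightarrow>\<^sub>0 int"
    unfolding augmentation_def using that
    by (intro sum.mono_neutral_left) (auto simp: in_keys_iff)
  show ?thesis
    using eq[of a] eq[of b] eq[of "a + b"] keys_add[of a b]
    by (simp add: lookup_add sum.distrib)
qed

lemma augmentation_diff: "augmentation (a - b) = augmentation a - augmentation b"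
  using augmentation_add[of "a - b" b] by simp

lemma augmentation_hom: "augmentation \<in> hom (free_Abelian_group S) integer_group"
  by (rule homI) (auto simp: augmentation_add)

lemma augmentation_frag_extend:
  assumes "\<And>x. augmentation (f x) = k"
  shows "augmentation (frag_extend f c) = k * augmentation c"
  using subset_UNIV[of "Poly_Mapping.keys c"]
  by (induction c rule: frag_induction)
    (auto simp: assms frag_extend_diff augmentation_diff algebra_simps)

text \<open>
  This turns the map that defines $\lambda_R$ on generators into the projection
  $c\mapsto c-\epsilon(c)0_1$.
\<close>

lemma frag_extend_diff_base:
  "frag_extend (\<lambda>x. frag_of x - b) c = c - frag_cmul (augmentation c) b"
  using subset_UNIV[of "Poly_Mapping.keys c"]
  by (induction c rule: frag_induction)
    (auto simp: frag_extend_diff augmentation_diff frag_cmul_diff_distrib)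

text \<open>
  The inclusion of \<open>h ` N\<close> in \<open>K\<close> makes the coset of \<open>h y\<close> the same for all \<open>y\<close> in the
  coset of \<open>x\<close>, which is what gives the value of \<open>the_elem\<close> in \<open>quotient_map\<close> a meaning.
\<close>

lemma quotient_map_coset:
  assumes G: "group G" and H: "group H" and h: "h \<in> hom G H"
    and N: "subgroup N G" and K: "subgroup K H" and hN: "h ` N \<subseteq> K" and x: "x \<in> carrier G"
  shows "quotient_map H K h (N #>\<^bsub>G\<^esub> x) = K #>\<^bsub>H\<^esub> h x"
proof -
  have const: "K #>\<^bsub>H\<^esub> h y = K #>\<^bsub>H\<^esub> h x" if y: "y \<in> N #>\<^bsub>G\<^esub> x" for y
  proof -
    obtain n where n: "n \<in> N" "y = n \<otimes>\<^bsub>G\<^esub> x"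
      using y by (auto simp: r_coset_def)
    have nG: "n \<in> carrier G" using subgroup.mem_carrier[OF N n(1)] .
    have "h n \<in> K" using n(1) hN by blast
    then have "K #>\<^bsub>H\<^esub> h n = K"
      using group.coset_join2[OF H _ K] hom_in_carrier[OF h nG] by blast
    then show ?thesis
      using group.coset_mult_assoc[OF H subgroup.subset[OF K] hom_in_carrier[OF h nG]
          hom_in_carrier[OF h x]] hom_mult[OF h nG x] n(2) by simp
  qed
  have "N #>\<^bsub>G\<^esub> x \<noteq> {}"
    using group.rcos_self[OF G x N] by blast
  then show ?thesis
    unfolding quotient_map_def using const by (rule the_elem_image_unique)
qed

lemma quotient_map_hom:
  assumes G: "comm_group G" and H: "comm_group H" and h: "h \<in> hom G H"
    and N: "subgroup N G" and K: "subgroup K H" and hN: "h ` N \<subseteq> K"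
  shows "quotient_map H K h \<in> hom (G Mod N) (H Mod K)"
proof (rule homI)
  note gG = comm_group.axioms(2)[OF G] and gH = comm_group.axioms(2)[OF H]
  note coset = quotient_map_coset[OF gG gH h N K hN]
  note sumN = normal.rcos_sum[OF comm_group.subgroup_imp_normal[OF G N]]
  note sumK = normal.rcos_sum[OF comm_group.subgroup_imp_normal[OF H K]]
  fix X assume "X \<in> carrier (G Mod N)"
  then obtain x where x: "x \<in> carrier G" "X = N #>\<^bsub>G\<^esub> x"
    by (auto simp: carrier_FactGroup)
  then show "quotient_map H K h X \<in> carrier (H Mod K)"
    by (auto simp: coset carrier_FactGroup intro!: imageI hom_in_carrier[OF h])
  fix Y assume "Y \<in> carrier (G Mod N)"
  then obtain y where y: "y \<in> carrier G" "Y = N #>\<^bsub>G\<^esub> y"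
    by (auto simp: carrier_FactGroup)
  show "quotient_map H K h (X \<otimes>\<^bsub>G Mod N\<^esub> Y)
      = quotient_map H K h X \<otimes>\<^bsub>H Mod K\<^esub> quotient_map H K h Y"
    using x y monoid.m_closed[OF group.is_monoid[OF gG] x(1) y(1)]
    by (simp add: sumN sumK coset hom_in_carrier[OF h] hom_mult[OF h])
qed

text \<open>
  If \<open>N\<close> is the full preimage of \<open>K\<close>, then elements whose images agree modulo \<open>K\<close> differ by an
  element of \<open>N\<close>, so the induced map is injective.
\<close>

lemma quotient_map_iso:
  assumes G: "comm_group G" and H: "comm_group H" and h: "h \<in> hom G H"
    and N: "subgroup N G" and K: "subgroup K H"
    and preimage: "\<And>x. x \<in> carrier G \<Longrightarrow> h x \<in> K \<longleftrightarrow> x \<in> N"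
    and surj: "carrier H \<subseteq> h ` carrier G"
  shows "quotient_map H K h \<in> iso (G Mod N) (H Mod K)"
proof -
  note gG = comm_group.axioms(2)[OF G] and gH = comm_group.axioms(2)[OF H]
  interpret G: group G by (rule gG)
  interpret H: group H by (rule gH)
  interpret h: group_hom G H h
    using h by unfold_locales
  have hN: "h ` N \<subseteq> K"
    using preimage subgroup.mem_carrier[OF N] by blast
  note coset = quotient_map_coset[OF gG gH h N K hN]
  have inj: "N #>\<^bsub>G\<^esub> x = N #>\<^bsub>G\<^esub> y"
    if x: "x \<in> carrier G" and y: "y \<in> carrier G" and eq: "K #>\<^bsub>H\<^esub> h x = K #>\<^bsub>H\<^esub> h y" for x y
  proof -
    have "h x \<in> K #>\<^bsub>H\<^esub> h y"
      using H.rcos_self[OF h.hom_closed[OF x] K] eq by simp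
    then obtain k where k: "k \<in> K" "h x = k \<otimes>\<^bsub>H\<^esub> h y"
      by (auto simp: r_coset_def)
    have "h (x \<otimes>\<^bsub>G\<^esub> inv\<^bsub>G\<^esub> y) = k"
      using x y k subgroup.mem_carrier[OF K k(1)] by (simp add: H.m_assoc)
    then have d: "x \<otimes>\<^bsub>G\<^esub> inv\<^bsub>G\<^esub> y \<in> N"
      using preimage[of "x \<otimes>\<^bsub>G\<^esub> inv\<^bsub>G\<^esub> y"] k(1) x y by simp
    have "N #>\<^bsub>G\<^esub> x = (N #>\<^bsub>G\<^esub> (x \<otimes>\<^bsub>G\<^esub> inv\<^bsub>G\<^esub> y)) #>\<^bsub>G\<^esub> y"
      using x y by (simp add: G.coset_mult_assoc[OF subgroup.subset[OF N]] G.m_assoc)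
    then show ?thesis
      using G.coset_join2[OF _ N d] x y by simp
  qed
  have "inj_on (quotient_map H K h) (carrier (G Mod N))"
  proof (rule inj_onI)
    fix X Y assume "X \<in> carrier (G Mod N)" and "Y \<in> carrier (G Mod N)"
      and eq: "quotient_map H K h X = quotient_map H K h Y"
    then obtain x y where "x \<in> carrier G" "X = N #>\<^bsub>G\<^esub> x" "y \<in> carrier G" "Y = N #>\<^bsub>G\<^esub> y"
      by (auto simp: carrier_FactGroup)
    then show "X = Y" using eq inj[of x y] by (simp add: coset)
  qed
  moreover have "quotient_map H K h ` carrier (G Mod N) = carrier (H Mod K)"
  proof -
    have "h ` carrier G = carrier H" using surj by auto
    then have "carrier (H Mod K) = (\<lambda>x. K #>\<^bsub>H\<^esub> h x) ` carrier G"
      unfolding carrier_FactGroup by (metis image_image)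
    then show ?thesis
      unfolding carrier_FactGroup image_image using coset by (simp cong: image_cong)
  qed
  ultimately have "bij_betw (quotient_map H K h) (carrier (G Mod N)) (carrier (H Mod K))"
    by (simp add: bij_betw_def)
  then show ?thesis
    using quotient_map_hom[OF G H h N K hN] by (simp add: iso_def)
qed

section \<open>Exchange relators, $0$-boundaries and $0$-cycles\<close>

text \<open>
  The two sides of the first family of relations of $G_0(R)$, subtracted; it will turn out to be
  the boundary of the class of $(B|A,A')$.
\<close>

definition exchange_element :: "('a, 'c) ring_scheme \<Rightarrow> 'a mat \<Rightarrow> 'a mat \<Rightarrow> 'a mat
    \<Rightarrow> (('a mat \<times> 'a mat) set \<Rightarrow>\<^sub>0 int)" where
  "exchange_element R B A A' =
     (frag_of (L_class R 1 (hcat B A, A')) - frag_of (L_class R 1 (B, A')))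
       - (frag_of (L_class R 1 (hcat B A', A)) - frag_of (L_class R 1 (B, A)))"

definition exchange_relators ::
    "('a, 'c) ring_scheme \<Rightarrow> (('a mat \<times> 'a mat) set \<Rightarrow>\<^sub>0 int) set" where
  "exchange_relators R = {exchange_element R B A A' | B A A' r m.
     B \<in> mats R r m \<and> A \<in> mats R r 1 \<and> A' \<in> mats R r 1}"

lemma G0_relators_eq: "G0_relators R = insert (frag_of (L_zero R)) (exchange_relators R)"
  unfolding G0_relators_def exchange_relators_def exchange_element_def by simp

lemma augmentation_exchange_relators: "c \<in> exchange_relators R \<Longrightarrow> augmentation c = 0"
  by (auto simp: exchange_relators_def exchange_element_def augmentation_diff)

context ring
begin

lemma L_class_column_in_L:
  assumes "B \<in> mats R r m" and "A \<in> mats R r 1" and "A' \<in> mats R r 1"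
  shows "L_class R 1 (B, A) \<in> L R 1" and "L_class R 1 (hcat B A', A) \<in> L R 1"
  using assms hcat_mats[OF assms(1,3)]
  by (intro L_class_in_L; unfold L_pre_iff; blast)+

text \<open>
  For two columns, deleting one leaves the other.  The index $0$ therefore contributes
  $[B,A_0|A_1]-[B|A_1]$, and the index $1$, with sign $-1$, contributes $[B,A_1|A_0]-[B|A_0]$.
\<close>

lemma boundary_class:
  assumes B: "B \<in> mats R r m" and A: "A \<in> mats R r 2"
  shows "boundary R 1 (frag_of (L_class R 2 (B, A)))
    = exchange_element R B (column A 0) (column A 1)"
proof -
  have "(B, A) \<in> L_pre R (Suc 1)"
    using B A by (auto simp: L_pre_iff numeral_2_eq_2)
  note faces = L_E_class[OF this] L_N_class[OF this]
  have remove: "remove_column A 0 = column A 1" "remove_column A 1 = column A 0"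
    using A by (auto intro!: eq_matI simp: remove_column_def column_def mats_iff)
  have two: "(2::nat) = Suc 1" by simp
  have ends: "{0..1::nat} = {0, 1}" by auto
  show ?thesis
    unfolding boundary_def frag_extend_of two ends
    by (simp add: faces[of 0, simplified] faces[of 1, simplified] remove[simplified]
        exchange_element_def)
qed

lemma exchange_element_in_carrier:
  assumes "B \<in> mats R r m" and "A \<in> mats R r 1" and "A' \<in> mats R r 1"
  shows "exchange_element R B A A' \<in> carrier (free_Abelian_group (L R 1))"
  unfolding exchange_element_def
  using L_class_column_in_L[OF assms] L_class_column_in_L[OF assms(1,3,2)]
  by (intro subgroup_free_diff[OF group.subgroup_self[OF group_free_Abelian_group]]) auto

lemma exchange_relators_subset: "exchange_relators R \<subseteq> carrier (free_Abelian_group (L R 1))"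
  unfolding exchange_relators_def using exchange_element_in_carrier by blast

lemma G0_relators_subset: "G0_relators R \<subseteq> carrier (free_Abelian_group (L R 1))"
  unfolding G0_relators_eq using exchange_relators_subset L_zero_in_L by auto

text \<open>
  Every matrix with two columns is the concatenation of its columns, so the boundaries of the
  generators of $Q_1(R)$ are all the exchange elements and nothing else.
\<close>

lemma B0_eq_generate: "B0 R = generate (free_Abelian_group (L R 1)) (exchange_relators R)"
proof -
  let ?F = "free_Abelian_group (L R 1)"
  interpret F: group ?F by simp
  have Q1: "Q R 1 = free_Abelian_group (L R 2)"
    by (simp add: Q_def numeral_2_eq_2)
  have generator: "boundary R 1 (frag_of X) \<in> exchange_relators R" if XL: "X \<in> L R 2" for X
  proof -
    obtain B A r m where X: "X = L_class R 2 (B, A)" and B: "B \<in> mats R r m" and A: "A \<in> mats R r 2"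
      using XL by (rule L_cases)
    have "column A 0 \<in> mats R r 1" and "column A 1 \<in> mats R r 1"
      using column_mats[OF A] by simp_all
    then show ?thesis
      unfolding X boundary_class[OF B A] exchange_relators_def
      using B by blast
  qed
  note sub = F.generate_is_subgroup[OF exchange_relators_subset]
  show ?thesis
  proof (intro equalityI)
    show "B0 R \<subseteq> generate ?F (exchange_relators R)"
      unfolding B0_def Q1 boundary_def
      using generator
      by (intro image_subsetI frag_extend_in_subgroup[OF sub])
        (auto simp: boundary_def intro: generate.incl)
    have "exchange_relators R \<subseteq> B0 R"
    proof
      fix c assume "c \<in> exchange_relators R"
      then obtain B A A' r m where c: "c = exchange_element R B A A'"
        and B: "B \<in> mats R r m" and A: "A \<in> mats R r 1" and A': "A' \<in> mats R r 1"
        unfolding exchange_relators_def by blast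
      have AA': "hcat A A' \<in> mats R r 2"
        using hcat_mats[OF A A'] by (simp add: numeral_2_eq_2)
      have "column (hcat A A') 0 = A" "column (hcat A A') 1 = A'"
        using A A' by (auto intro!: eq_matI simp: column_def hcat_def mats_iff)
      then have "c = boundary R 1 (frag_of (L_class R 2 (B, hcat A A')))"
        unfolding c boundary_class[OF B AA'] by simp
      moreover have "L_class R 2 (B, hcat A A') \<in> L R 2"
        using B AA' by (intro L_class_in_L) (auto simp: L_pre_iff)
      ultimately show "c \<in> B0 R"
        unfolding B0_def Q1 by auto
    qed
    moreover have "subgroup (B0 R) ?F"
    proof -
      have "boundary R 1 \<in> hom (Q R 1) ?F"
        unfolding Q1 boundary_def
        using generator exchange_relators_subset
        by (intro frag_extend_hom)
          (auto simp: boundary_def simp del: carrier_free_Abelian_group_iff)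
      then show ?thesis
        unfolding B0_def Q1
        by (intro group_hom.img_is_subgroup group_hom.intro group_hom_axioms.intro) auto
    qed
    ultimately show "generate ?F (exchange_relators R) \<subseteq> B0 R"
      by (rule F.generate_subgroup_incl)
  qed
qed

end

context ring
begin

lemma G0_kernel_eq_generate:
  "G0_kernel R = generate (free_Abelian_group (L R 1))
     (insert (frag_of (L_zero R)) (exchange_relators R))"
  unfolding G0_kernel_def G0_relators_eq ..

lemma G0_kernel_subgroup: "subgroup (G0_kernel R) (free_Abelian_group (L R 1))"
  unfolding G0_kernel_def
  by (rule group.generate_is_subgroup[OF group_free_Abelian_group G0_relators_subset])

lemma B0_subgroup: "subgroup (B0 R) (free_Abelian_group (L R 1))"
  unfolding B0_eq_generate
  by (rule group.generate_is_subgroup[OF group_free_Abelian_group exchange_relators_subset])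

lemma Q_0: "Q R 0 = free_Abelian_group (L R 1)"
  by (simp add: Q_def)

lemma Z0_eq: "Z0 R = {c \<in> carrier (free_Abelian_group (L R 1)). augmentation c = 0}"
  unfolding Z0_def Q_0 kernel_def by simp

lemma Z0_subgroup: "subgroup (Z0 R) (free_Abelian_group (L R 1))"
  unfolding Z0_def Q_0
  by (intro group_hom.subgroup_kernel group_hom.intro group_hom_axioms.intro augmentation_hom)
    auto

lemma B0_subset_Z0: "B0 R \<subseteq> Z0 R"
  unfolding B0_eq_generate
proof (rule group.generate_subgroup_incl[OF group_free_Abelian_group _ Z0_subgroup])
  show "exchange_relators R \<subseteq> Z0 R"
    unfolding Z0_eq using exchange_relators_subset augmentation_exchange_relators by blast
qed

abbreviation cycle_group :: "(('a mat \<times> 'a mat) set \<Rightarrow>\<^sub>0 int) monoid" where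
  "cycle_group \<equiv> (Q R 0)\<lparr>carrier := Z0 R\<rparr>"

lemma cycle_group_comm_group: "comm_group cycle_group"
proof (rule group.group_comm_groupI)
  show "group cycle_group"
    unfolding Q_0 by (rule subgroup.subgroup_is_group[OF Z0_subgroup group_free_Abelian_group])
qed (simp add: Q_0 add.commute)

lemma B0_subgroup_cycle_group: "subgroup (B0 R) cycle_group"
  unfolding Q_0
  by (rule group.subgroup_incl[OF group_free_Abelian_group B0_subgroup Z0_subgroup B0_subset_Z0])

text \<open>
  The map $c\mapsto c-\epsilon(c)0_1$ fixes the exchange relators, whose augmentation vanishes,
  and kills $0_1$; hence it carries the relations of $G_0(R)$ to boundaries.  Conversely $c$
  differs from its image by a multiple of the relator $0_1$.
\<close>

lemma difference_in_B0_iff: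
  assumes "c \<in> carrier (free_Abelian_group (L R 1))"
  shows "c - frag_cmul (augmentation c) (frag_of (L_zero R)) \<in> B0 R \<longleftrightarrow> c \<in> G0_kernel R"
proof
  let ?p = "\<lambda>c. c - frag_cmul (augmentation c) (frag_of (L_zero R))"
  have zero: "frag_of (L_zero R) \<in> G0_kernel R"
    unfolding G0_kernel_eq_generate by (rule generate.incl) simp
  have "B0 R \<subseteq> G0_kernel R"
    unfolding B0_eq_generate G0_kernel_eq_generate
    by (rule group.mono_generate[OF group_free_Abelian_group]) auto
  moreover assume "?p c \<in> B0 R"
  ultimately have "?p c \<in> G0_kernel R" by blast
  moreover have "frag_cmul (- augmentation c) (frag_of (L_zero R)) \<in> G0_kernel R"
    by (rule subgroup_free_cmul[OF G0_kernel_subgroup zero])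
  ultimately have "?p c - frag_cmul (- augmentation c) (frag_of (L_zero R)) \<in> G0_kernel R"
    by (rule subgroup_free_diff[OF G0_kernel_subgroup])
  then show "c \<in> G0_kernel R"
    by (simp add: minus_frag_cmul[symmetric] del: minus_frag_cmul)
next
  let ?F = "free_Abelian_group (L R 1)"
  let ?p = "\<lambda>c. c - frag_cmul (augmentation c) (frag_of (L_zero R))"
  have "?p = frag_extend (\<lambda>X. frag_of X - frag_of (L_zero R))"
    by (simp add: frag_extend_diff_base fun_eq_iff)
  moreover have "frag_of X - frag_of (L_zero R) \<in> carrier ?F" if "X \<in> L R 1" for X
    using that L_zero_in_L
    by (intro subgroup_free_diff[OF group.subgroup_self[OF group_free_Abelian_group]]) auto
  ultimately have "?p \<in> hom ?F ?F"
    by (simp add: frag_extend_hom)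
  then interpret p: group_hom ?F ?F ?p
    by (intro group_hom.intro group_hom_axioms.intro) auto
  have "?p ` G0_relators R \<subseteq> B0 R"
  proof -
    have "?p r = r" if "r \<in> exchange_relators R" for r
      using augmentation_exchange_relators[OF that] by simp
    moreover have "exchange_relators R \<subseteq> B0 R"
      unfolding B0_eq_generate by (auto intro: generate.incl)
    ultimately show ?thesis
      unfolding G0_relators_eq using subgroup.one_closed[OF B0_subgroup] by auto
  qed
  then have "?p ` G0_kernel R \<subseteq> B0 R"
    unfolding G0_kernel_def p.generate_img[OF G0_relators_subset, symmetric]
    by (rule group.generate_subgroup_incl[OF group_free_Abelian_group _ B0_subgroup])
  moreover assume "c \<in> G0_kernel R"
  ultimately show "?p c \<in> B0 R" by blast
qed

lemma difference_map_hom: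
  "frag_extend (\<lambda>X. frag_of X - frag_of (L_zero R)) \<in> hom (free_Abelian_group (L R 1)) cycle_group"
proof (rule homI)
  fix c assume "c \<in> carrier (free_Abelian_group (L R 1))"
  moreover have "frag_of X - frag_of (L_zero R) \<in> Z0 R" if "X \<in> L R 1" for X
    unfolding Z0_eq using that L_zero_in_L
    by (auto simp: augmentation_diff dest!: subsetD[OF keys_diff])
  ultimately have "frag_extend (\<lambda>X. frag_of X - frag_of (L_zero R)) c \<in> Z0 R"
    by (intro frag_extend_in_subgroup[OF Z0_subgroup])
  then show "frag_extend (\<lambda>X. frag_of X - frag_of (L_zero R)) c \<in> carrier cycle_group"
    by simp
qed (simp add: Q_0 frag_extend_add)

lemma lambda_map_coset:
  assumes "c \<in> carrier (free_Abelian_group (L R 1))"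
  shows "lambda_map R (G0_class R c)
    = H0_class R (c - frag_cmul (augmentation c) (frag_of (L_zero R)))"
  unfolding lambda_map_def G0_class_def H0_class_def frag_extend_diff_base[symmetric]
  by (intro quotient_map_coset difference_map_hom G0_kernel_subgroup B0_subgroup_cycle_group assms
      comm_group.axioms(2)[OF cycle_group_comm_group] group_free_Abelian_group)
    (use subgroup.mem_carrier[OF G0_kernel_subgroup] difference_in_B0_iff in
      \<open>auto simp: frag_extend_diff_base\<close>)

text \<open>
  By \<open>difference_in_B0_iff\<close> the kernel of $Q_0(R)\to H_0(R)$ is the group of relations of
  $G_0(R)$; and $c\mapsto c-\epsilon(c)0_1$ is onto, being the identity on $0$-cycles.
\<close>

lemma lambda_map_iso: "lambda_map R \<in> iso (G0 R) (H0 R)"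
  unfolding lambda_map_def G0_def H0_def
proof (rule quotient_map_iso)
  show "comm_group (free_Abelian_group (L R 1))"
    by (rule abelian_free_Abelian_group)
  show "carrier cycle_group
      \<subseteq> frag_extend (\<lambda>X. frag_of X - frag_of (L_zero R)) ` carrier (free_Abelian_group (L R 1))"
  proof
    fix c assume "c \<in> carrier cycle_group"
    then have "c \<in> carrier (free_Abelian_group (L R 1))" and "augmentation c = 0"
      by (auto simp: Z0_eq)
    then show "c \<in> frag_extend (\<lambda>X. frag_of X - frag_of (L_zero R)) ` carrier (free_Abelian_group (L R 1))"
      by (intro image_eqI[of _ _ c]) (auto simp: frag_extend_diff_base)
  qed
qed (simp_all add: cycle_group_comm_group difference_map_hom G0_kernel_subgroup
    B0_subgroup_cycle_group frag_extend_diff_base difference_in_B0_iff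
    del: carrier_free_Abelian_group_iff One_nat_def)

lemma G0_comm_group: "comm_group (G0 R)"
  unfolding G0_def
  by (rule comm_group.abelian_FactGroup[OF abelian_free_Abelian_group G0_kernel_subgroup])

lemma H0_comm_group: "comm_group (H0 R)"
  unfolding H0_def
  by (rule comm_group.abelian_FactGroup[OF cycle_group_comm_group B0_subgroup_cycle_group])

end

section \<open>Naturality\<close>

lemma augmentation_free_map: "augmentation (free_map S f c) = augmentation c"
  unfolding free_map_def by (subst augmentation_frag_extend[where k = 1]) auto

context ring_hom_ring
begin

lemma free_map_hom:
  "free_map S h \<in> hom (free_Abelian_group (L R 1)) (free_Abelian_group (L S 1))"
  unfolding free_map_def by (rule frag_extend_hom) (simp add: L_map_in_L)

lemma free_map_L_zero: "free_map S h (frag_of (L_zero R)) = frag_of (L_zero S)"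
  unfolding free_map_def using L_map_L_zero by simp

text \<open>
  A morphism applied entrywise commutes with concatenation, so it sends the exchange element of
  $(B,A,A')$ to that of the image matrices.
\<close>

lemma free_map_exchange_relators: "free_map S h ` exchange_relators R \<subseteq> exchange_relators S"
proof
  fix c assume "c \<in> free_map S h ` exchange_relators R"
  then obtain B A A' r m where c: "c = free_map S h (exchange_element R B A A')"
    and B: "B \<in> mats R r m" and A: "A \<in> mats R r 1" and A': "A' \<in> mats R r 1"
    unfolding exchange_relators_def by blast
  have pre: "(B, A) \<in> L_pre R 1" "(B, A') \<in> L_pre R 1"
    "(hcat B A, A') \<in> L_pre R 1" "(hcat B A', A) \<in> L_pre R 1"
    unfolding L_pre_iff using B A A' hcat_mats[OF B A] hcat_mats[OF B A'] by blast+
  have "map_mat h (hcat B A) = hcat (map_mat h B) (map_mat h A)"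
    "map_mat h (hcat B A') = hcat (map_mat h B) (map_mat h A')"
    using B A A' by (auto simp: mats_dim intro!: map_mat_hcat)
  then have "c = exchange_element S (map_mat h B) (map_mat h A) (map_mat h A')"
    unfolding c exchange_element_def free_map_def frag_extend_diff frag_extend_of
      pre[THEN L_map_class] by simp
  then show "c \<in> exchange_relators S"
    unfolding exchange_relators_def
    using map_mat_mats[OF homh B] map_mat_mats[OF homh A] map_mat_mats[OF homh A'] by blast
qed

lemma free_map_generate:
  assumes "T \<subseteq> carrier (free_Abelian_group (L R 1))" and "free_map S h ` T \<subseteq> T'"
  shows "free_map S h ` generate (free_Abelian_group (L R 1)) T
    \<subseteq> generate (free_Abelian_group (L S 1)) T'"
proof -
  interpret F: group_hom "free_Abelian_group (L R 1)" "free_Abelian_group (L S 1)" "free_map S h"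
    by (intro group_hom.intro group_hom_axioms.intro free_map_hom) auto
  show ?thesis
    unfolding F.generate_img[OF assms(1), symmetric]
    by (rule group.mono_generate[OF group_free_Abelian_group assms(2)])
qed

lemma free_map_G0_kernel: "free_map S h ` G0_kernel R \<subseteq> G0_kernel S"
  unfolding R.G0_kernel_eq_generate S.G0_kernel_eq_generate
  using free_map_exchange_relators R.exchange_relators_subset R.L_zero_in_L
  by (intro free_map_generate) (auto simp: free_map_L_zero)

lemma free_map_B0: "free_map S h ` B0 R \<subseteq> B0 S"
  unfolding R.B0_eq_generate S.B0_eq_generate
  by (rule free_map_generate[OF R.exchange_relators_subset free_map_exchange_relators])

lemma free_map_hom_cycles: "free_map S h \<in> hom R.cycle_group S.cycle_group"
proof (rule homI)
  fix c assume "c \<in> carrier R.cycle_group"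
  then have "c \<in> carrier (free_Abelian_group (L R 1))" and "augmentation c = 0"
    by (auto simp: R.Z0_eq)
  then show "free_map S h c \<in> carrier S.cycle_group"
    using hom_in_carrier[OF free_map_hom, of c] by (auto simp: S.Z0_eq augmentation_free_map)
qed (simp add: Q_def free_map_def frag_extend_add)

lemma G0_map_hom: "G0_map S h \<in> hom (G0 R) (G0 S)"
  unfolding G0_map_def G0_def
  by (intro quotient_map_hom abelian_free_Abelian_group free_map_hom R.G0_kernel_subgroup
      S.G0_kernel_subgroup free_map_G0_kernel)

lemma H0_map_hom: "H0_map S h \<in> hom (H0 R) (H0 S)"
  unfolding H0_map_def H0_def
  by (intro quotient_map_hom R.cycle_group_comm_group S.cycle_group_comm_group
      free_map_hom_cycles R.B0_subgroup_cycle_group S.B0_subgroup_cycle_group free_map_B0)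

lemma G0_map_class:
  assumes "c \<in> carrier (free_Abelian_group (L R 1))"
  shows "G0_map S h (G0_class R c) = G0_class S (free_map S h c)"
  unfolding G0_map_def G0_class_def
  by (intro quotient_map_coset group_free_Abelian_group free_map_hom R.G0_kernel_subgroup
      S.G0_kernel_subgroup free_map_G0_kernel assms)

lemma H0_map_class:
  assumes "c \<in> Z0 R"
  shows "H0_map S h (H0_class R c) = H0_class S (free_map S h c)"
  unfolding H0_map_def H0_class_def
  by (intro quotient_map_coset free_map_hom_cycles R.B0_subgroup_cycle_group
      S.B0_subgroup_cycle_group free_map_B0 comm_group.axioms(2)[OF R.cycle_group_comm_group]
      comm_group.axioms(2)[OF S.cycle_group_comm_group]) (simp add: assms)

text \<open>
  Both composites send the class of $c$ to the class of $f(c)-\epsilon(c)0_1$, as $f$ preserves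
  $0_1$ and $\epsilon$.
\<close>

lemma lambda_map_natural:
  assumes "X \<in> carrier (G0 R)"
  shows "H0_map S h (lambda_map R X) = lambda_map S (G0_map S h X)"
proof -
  obtain c where c: "c \<in> carrier (free_Abelian_group (L R 1))" and X: "X = G0_class R c"
    using assms unfolding G0_def G0_class_def by (auto simp: carrier_FactGroup)
  have "c - frag_cmul (augmentation c) (frag_of (L_zero R)) \<in> Z0 R"
    using hom_in_carrier[OF R.difference_map_hom c] by (simp add: frag_extend_diff_base)
  moreover have "free_map S h (c - frag_cmul (augmentation c) (frag_of (L_zero R)))
      = free_map S h c - frag_cmul (augmentation (free_map S h c)) (frag_of (L_zero S))"
    by (subst augmentation_free_map)
      (simp add: free_map_def frag_extend_diff frag_extend_cmul L_map_L_zero[simplified])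
  ultimately show ?thesis
    unfolding X R.lambda_map_coset[OF c] G0_map_class[OF c]
      S.lambda_map_coset[OF hom_in_carrier[OF free_map_hom c]]
    by (simp add: H0_map_class)
qed

end

section \<open>The isomorphism between $G_0(R)$ and $H_0(R)$\<close>

theorem theorem33:
  fixes R :: "('a, 'c) ring_scheme"
  assumes "ring R"
  shows "comm_group (G0 R) \<and> comm_group (H0 R)
    \<and> lambda_map R \<in> iso (G0 R) (H0 R)
    \<and> (\<forall>(B, A) \<in> L_pre R 1.
         lambda_map R (G0_class R (frag_of (L_class R 1 (B, A))))
           = H0_class R (frag_of (L_class R 1 (B, A)) - frag_of (L_zero R)))
    \<and> (\<forall>(S :: ('b, 'd) ring_scheme) f. ring S \<longrightarrow> f \<in> ring_hom R S \<longrightarrow>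
         G0_map S f \<in> hom (G0 R) (G0 S) \<and> H0_map S f \<in> hom (H0 R) (H0 S)
         \<and> (\<forall>X \<in> carrier (G0 R). H0_map S f (lambda_map R X) = lambda_map S (G0_map S f X)))"
proof -
  interpret R: ring R by fact
  have "lambda_map R (G0_class R (frag_of (L_class R 1 (B, A))))
      = H0_class R (frag_of (L_class R 1 (B, A)) - frag_of (L_zero R))"
    if "(B, A) \<in> L_pre R 1" for B A
    using R.lambda_map_coset[of "frag_of (L_class R 1 (B, A))"] R.L_class_in_L[OF that] by simp
  moreover have "G0_map S f \<in> hom (G0 R) (G0 S) \<and> H0_map S f \<in> hom (H0 R) (H0 S)
      \<and> (\<forall>X \<in> carrier (G0 R). H0_map S f (lambda_map R X) = lambda_map S (G0_map S f X))"
    if "ring S" and "f \<in> ring_hom R S" for S :: "('b, 'd) ring_scheme" and f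
  proof -
    interpret f: ring_hom_ring R S f
      by (rule ring_hom_ringI2[OF assms that])
    show ?thesis
      using f.G0_map_hom f.H0_map_hom f.lambda_map_natural by blast
  qed
  ultimately show ?thesis
    using R.G0_comm_group R.H0_comm_group R.lambda_map_iso by blast
qed

end
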